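(* Let $E$ be a Banach space and let $\tau$ be a Hausdorff topology on $E$. Let $\{ T(t) : t \geq 0 \}$ be a one-parameter $\tau$-continuous semigroup of mappings on a subset $C$ of $E$. Then $$ \bigcap_{t \geq 0} F \big( T(t) \big) = F \big( T(1) \big) \cap F \big( T(\sqrt 2) \big) $$ holds.
   Context: For a mapping $S : C \to C$, $F(S) = \{x \in C : Sx = x\}$ denotes its set of fixed points. Let $C$ be a subset of a Banach space $E$ and let $\tau$ be a Hausdorff topology on $E$ (not necessarily the norm topology). A family $\{T(t) : t \geq 0\}$ of mappings from $C$ into $C$ is called a one-parameter $\tau$-continuous semigroup of mappings on $C$ if: (sg 1) $T(s+t) = T(s) \circ T(t)$ for all $s, t \geq 0$; (sg 2) for each $x \in C$, the mapping $t \mapsto T(t)x$ from $[0,\infty)$ into $C$ is continuous with respect to $\tau$. (It is not required that $T(0)$ be the identity mapping.) *)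

theory Defs
  imports "HOL-Analysis.Analysis"
begin

definition fixed_points :: "'a set \<Rightarrow> ('a \<Rightarrow> 'a) \<Rightarrow> 'a set" where
  "fixed_points C S = {x \<in> C. S x = x}"

text \<open>Mappings on \<open>C\<close> are total functions of which only the values on \<open>C\<close> matter, and
  \<open>T t\<close> is unconstrained for \<open>t < 0\<close>. As \<open>\<tau>\<close> need not be the norm topology, it is a value of
  type \<open>'a topology\<close>. Note that \<open>T 0\<close> need not be the identity on \<open>C\<close>.\<close>

definition one_parameter_continuous_semigroup ::
  "'a topology \<Rightarrow> 'a set \<Rightarrow> (real \<Rightarrow> 'a \<Rightarrow> 'a) \<Rightarrow> bool" where
  "one_parameter_continuous_semigroup \<tau> C T \<longleftrightarrow>
     (\<forall>t\<ge>0. T t \<in> C \<rightarrow> C) \<and>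
     (\<forall>s\<ge>0. \<forall>t\<ge>0. \<forall>x\<in>C. T (s + t) x = (T s \<circ> T t) x) \<and>
     (\<forall>x\<in>C. continuous_map (top_of_set {0..}) (subtopology \<tau> C) (\<lambda>t. T t x))"

end

theory Submission
  imports Defs
begin

text \<open>The times \<open>t\<close> such that \<open>T \<bar>t\<bar>\<close> fixes a given point \<open>x\<close> form an additive subgroup of \<open>\<real>\<close>:
  if \<open>T s x = x\<close> and \<open>T t x = x\<close> with \<open>s \<le> t\<close>, then \<open>T (t - s) x = T (t - s) (T s x) = T t x = x\<close>.
  As \<open>\<tau>\<close> is Hausdorff, the subgroup is closed. If it contains \<open>1\<close> and \<open>sqrt 2\<close>, it is dense,
  since \<open>sqrt 2\<close> is irrational, and hence it is all of \<open>\<real>\<close>.\<close>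

lemma sqrt_2_irrational: "sqrt 2 \<notin> \<rat>"
proof
  assume "sqrt 2 \<in> \<rat>"
  then obtain a b :: int where b: "b > 0" "coprime a b" and ab: "sqrt 2 = a / b"
    by (metis Rats_cases')
  have "(of_int a :: real)\<^sup>2 = (sqrt 2 * of_int b)\<^sup>2"
    using b ab by simp
  then have "real_of_int (a\<^sup>2) = of_int (2 * b\<^sup>2)"
    by (simp add: power_mult_distrib)
  then have eq: "a\<^sup>2 = 2 * b\<^sup>2"
    by (simp only: of_int_eq_iff)
  then have "even a"
    by (metis dvd_triv_left even_power)
  then obtain c where "a = 2 * c" ..
  then have "b\<^sup>2 = 2 * c\<^sup>2"
    using eq by (simp add: power_mult_distrib)
  then have "even b"
    by (metis dvd_triv_left even_power)
  with \<open>even a\<close> b show False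
    by (meson coprime_common_divisor odd_one)
qed

text \<open>Closure under differences yields \<open>0\<close>, negatives, sums and so all integer
  combinations of \<open>1\<close> and \<open>\<theta>\<close>. By Kronecker's approximation theorem
  these are dense for irrational \<open>\<theta>\<close>, and a closed dense set is
  everything.\<close>

lemma closed_additive_subgroup_eq_UNIV:
  fixes G :: "real set"
  assumes "closed G"
    and diff: "\<And>s t. s \<in> G \<Longrightarrow> t \<in> G \<Longrightarrow> s - t \<in> G"
    and "1 \<in> G" "\<theta> \<in> G" "\<theta> \<notin> \<rat>"
  shows "G = UNIV"
proof -
  have zero: "0 \<in> G"
    using diff[OF \<open>1 \<in> G\<close> \<open>1 \<in> G\<close>] by simp
  have minus: "- s \<in> G" if "s \<in> G" for s
    using diff[OF zero that] by simp
  have add: "s + t \<in> G" if "s \<in> G" "t \<in> G" for s t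
    using diff[OF that(1) minus[OF that(2)]] by simp
  have nat_mult: "of_nat n * s \<in> G" if "s \<in> G" for n s
    by (induction n) (auto simp: zero add that distrib_right)
  have int_mult: "of_int k * s \<in> G" if "s \<in> G" for k s
    using nat_mult[OF that] minus[OF nat_mult[OF that]] by (cases k rule: int_cases2) simp_all
  have "\<alpha> \<in> closure G" for \<alpha>
    unfolding closure_approachable
  proof (intro allI impI)
    fix \<epsilon> :: real
    assume "\<epsilon> > 0"
    then obtain h k where "\<bar>of_int k * \<theta> - of_int h - \<alpha>\<bar> < \<epsilon>"
      by (rule sequence_of_fractional_parts_is_dense[OF \<open>\<theta> \<notin> \<rat>\<close>])
    moreover have "of_int k * \<theta> - of_int h \<in> G"
      using diff[OF int_mult[OF \<open>\<theta> \<in> G\<close>] int_mult[OF \<open>1 \<in> G\<close>]] by simp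
    ultimately show "\<exists>y\<in>G. dist y \<alpha> < \<epsilon>"
      by (auto simp: dist_real_def)
  qed
  then show ?thesis
    using \<open>closed G\<close> by auto
qed

text \<open>The set is the equalizer of the orbit map and the constant map \<open>x\<close>, both
  continuous into a Hausdorff space. Composing with the absolute value extends the orbit from the
  half-line to all of the reals.\<close>

lemma closed_fixing_times:
  assumes "Hausdorff_space \<tau>" "one_parameter_continuous_semigroup \<tau> C T" "x \<in> C"
    and "x \<in> topspace \<tau>"
  shows "closed {t. T \<bar>t\<bar> x = x}"
proof -
  have orbit: "continuous_map (top_of_set {0..}) \<tau> (\<lambda>t. T t x)"
    using assms(2,3)
    by (auto simp: one_parameter_continuous_semigroup_def continuous_map_in_subtopology)
  have "continuous_map euclideanreal (top_of_set {0..}) (\<lambda>t::real. \<bar>t\<bar>)"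
    by (auto simp: continuous_map_in_subtopology intro: continuous_intros)
  then have "continuous_map euclideanreal \<tau> (\<lambda>t. T \<bar>t\<bar> x)"
    using continuous_map_compose[OF _ orbit] by (simp add: o_def)
  then show ?thesis
    using closedin_continuous_maps_eq[OF assms(1), of euclideanreal "\<lambda>t. T \<bar>t\<bar> x" "\<lambda>_. x"] assms(4)
    by simp
qed

lemma fixing_times_diff:
  assumes "one_parameter_continuous_semigroup \<tau> C T" "x \<in> C"
    and "T \<bar>s\<bar> x = x" "T \<bar>t\<bar> x = x"
  shows "T \<bar>s - t\<bar> x = x"
proof -
  have add: "T (u + v) x = T u (T v x)" if "u \<ge> 0" "v \<ge> 0" for u v
    using assms(1,2) that by (simp add: one_parameter_continuous_semigroup_def)
  \<comment> \<open>This includes \<open>u = v\<close>: although \<open>T 0\<close> need not be the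
    identity, \<open>T 0 x = T 0 (T u x) = T u x = x\<close>.\<close>
  have fix_diff: "T (v - u) x = x" if "0 \<le> u" "u \<le> v" "T u x = x" "T v x = x" for u v
    using add[of "v - u" u] that by simp
  \<comment> \<open>Opposite signs make the absolute values add up, so \<open>add\<close> applies;
    equal signs make them subtract, so \<open>fix_diff\<close> applies with the smaller one as
    \<open>u\<close>.\<close>
  consider "\<bar>s - t\<bar> = \<bar>s\<bar> + \<bar>t\<bar>" | "\<bar>s - t\<bar> = \<bar>s\<bar> - \<bar>t\<bar>" "\<bar>t\<bar> \<le> \<bar>s\<bar>"
    | "\<bar>s - t\<bar> = \<bar>t\<bar> - \<bar>s\<bar>" "\<bar>s\<bar> \<le> \<bar>t\<bar>"
    by linarith
  then show ?thesis
    using add fix_diff assms(3,4) by cases simp_all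
qed

theorem corollary1:
  fixes \<tau> :: "'a::banach topology"
    and C :: "'a set"
    and T :: "real \<Rightarrow> 'a \<Rightarrow> 'a"
  assumes "topspace \<tau> = UNIV"
    and "Hausdorff_space \<tau>"
    and "one_parameter_continuous_semigroup \<tau> C T"
  shows "(\<Inter>t\<in>{0..}. fixed_points C (T t)) =
    fixed_points C (T 1) \<inter> fixed_points C (T (sqrt 2))"
proof
  show "(\<Inter>t\<in>{0..}. fixed_points C (T t)) \<subseteq> fixed_points C (T 1) \<inter> fixed_points C (T (sqrt 2))"
    by auto
  show "fixed_points C (T 1) \<inter> fixed_points C (T (sqrt 2)) \<subseteq> (\<Inter>t\<in>{0..}. fixed_points C (T t))"
  proof
    fix x
    assume "x \<in> fixed_points C (T 1) \<inter> fixed_points C (T (sqrt 2))"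
    then have x: "x \<in> C" "T 1 x = x" "T (sqrt 2) x = x"
      by (auto simp: fixed_points_def)
    have "{t. T \<bar>t\<bar> x = x} = UNIV"
    proof (rule closed_additive_subgroup_eq_UNIV)
      show "closed {t. T \<bar>t\<bar> x = x}"
        using closed_fixing_times[OF assms(2,3) x(1)] assms(1) by simp
      show "s - t \<in> {t. T \<bar>t\<bar> x = x}"
        if "s \<in> {t. T \<bar>t\<bar> x = x}" "t \<in> {t. T \<bar>t\<bar> x = x}" for s t
        using fixing_times_diff[OF assms(3) x(1)] that by blast
    qed (use sqrt_2_irrational x in simp_all)
    then have "T t x = x" if "t \<ge> 0" for t
      using that by (metis (full_types) UNIV_I abs_of_nonneg mem_Collect_eq)
    with x(1) show "x \<in> (\<Inter>t\<in>{0..}. fixed_points C (T t))"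
      by (simp add: fixed_points_def)
  qed
qed

end
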